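(* Let $R$ be a GCD domain and let $(G,\beta)$ be an edge-labeled graph over $R$ with vertices $v_1,\dots,v_n$, vertex labels $m_1,\dots,m_n\in R$ and edge labels $r_1,\dots,r_k\in R$, where all the $m_i$ and $r_j$ are pairwise relatively prime (i.e. any two members of the list $m_1,\dots,m_n,r_1,\dots,r_k$ have gcd $1$). If the module $\hat R_G$ is free with basis $\{F_1,F_2,\dots,F_n\}$, then $$\lvert F_1,F_2,\dots,F_n\rvert = u\,\hat Q_G$$ for some unit $u\in R$.
   Context: Let $G=(V,E)$ be a finite simple graph with ordered vertices $v_1,\dots,v_n$. Each vertex $v_i$ carries a label $m_i\in R$, with associated $R$-module $M_{v_i}=m_iR$; each edge $e$ carries a label $r_e\in R$ (with edges $e_1,\dots,e_k$, write $r_\ell=r_{e_\ell}$), with associated $R$-module $\beta(e)=M_e=R/r_eR$. For a vertex $v$ incident to an edge $e$, the map $M_v\to M_e$ is the natural one (inclusion $M_v\subseteq R$ followed by the quotient map $R\to R/r_eR$). The $R$-module of (extending generalized) splines is $$\hat R_G=\{(f_1,\dots,f_n)\in R^n : f_i\in m_iR \text{ for all } i,\ \text{and } f_i-f_j\in r_eR \text{ for every edge } e=v_iv_j\}.$$ For splines $F_i=(f_{i1},\dots,f_{in})$, $i=1,\dots,n$, $\lvert F_1,\dots,F_n\rvert$ denotes the determinant of the $n\times n$ matrix whose $i$-th column is $F_i$ written from bottom to top, i.e. $(f_{in},\dots,f_{i2},f_{i1})^T$. Write $(\ )$ for greatest common divisor and $[\ ]$ for least common multiple; these are defined up to units of $R$,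 and the lcm of the empty set is $1$. A trail $P_{ji}$ from $v_j$ to $v_i$ is a sequence of vertices and edges, consecutive ones incident, starting at $v_j$ and ending at $v_i$, in which no edge is repeated. $(P_{ji})$ denotes the gcd of the labels of the edges of $P_{ji}$, and $\{(P_{ji})\}$ denotes the set of these gcds over all trails from $v_j$ to $v_i$. Define $$\mathcal Q^{(i)}=\Big[\,m_i,\ \{(m_j,[\{(P_{ji})\}]) : j>i\},\ \{[\{(P_{si})\}] : s<i\}\,\Big],\qquad \hat Q_G=\prod_{i=1}^n\mathcal Q^{(i)},$$ so $\hat Q_G$ is an element of $R$ determined up to a unit. *)

theory Defs
  imports "Jordan_Normal_Form.Determinant" "Jordan_Normal_Form.VS_Connect"
begin

text \<open>
  The vertices \<open>v\<^sub>1, \<dots>, v\<^sub>n\<close> are the numbers \<open>0, \<dots>, n - 1\<close> in their usual order.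
  An edge is the two-element set of its endpoints.
\<close>

definition simple_graph :: "nat \<Rightarrow> nat set set \<Rightarrow> bool" where
  "simple_graph n E \<longleftrightarrow> (\<forall>e\<in>E. e \<subseteq> {..<n} \<and> card e = 2)"

text \<open>
  In a simple graph the vertices of a trail determine its edges, so a trail is given by its
  nonempty list of vertices.
\<close>

fun walk_edges :: "nat list \<Rightarrow> nat set list" where
  "walk_edges (x # y # zs) = {x, y} # walk_edges (y # zs)"
| "walk_edges _ = []"

definition is_trail :: "nat set set \<Rightarrow> nat \<Rightarrow> nat list \<Rightarrow> nat \<Rightarrow> bool" where
  "is_trail E j p i \<longleftrightarrow> p \<noteq> [] \<and> hd p = j \<and> last p = i \<and>
     set (walk_edges p) \<subseteq> E \<and> distinct (walk_edges p)"

text \<open>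
  A GCD domain is rendered by the class \<^class>\<open>ring_gcd\<close>: a commutative integral domain with
  chosen normalised gcds and lcms of pairs. Only finite sets have an lcm there; \<open>Lcm\<^sub>f\<^sub>i\<^sub>n\<close> of an
  infinite set is \<open>0\<close>, but all sets below are finite, and \<open>Lcm\<^sub>f\<^sub>i\<^sub>n {} = 1\<close>.
\<close>

definition trail_gcd :: "(nat set \<Rightarrow> 'a::ring_gcd) \<Rightarrow> nat list \<Rightarrow> 'a" where
  "trail_gcd r p = Gcd\<^sub>f\<^sub>i\<^sub>n (r ` set (walk_edges p))"

definition trail_gcds :: "nat set set \<Rightarrow> (nat set \<Rightarrow> 'a::ring_gcd) \<Rightarrow> nat \<Rightarrow> nat \<Rightarrow> 'a set" where
  "trail_gcds E r j i = {trail_gcd r p | p. is_trail E j p i}"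

lemma finite_trail_gcds:
  assumes "simple_graph n E"
  shows "finite (trail_gcds E r j i)"
proof -
  have "E \<subseteq> Pow {..<n}"
    using assms by (auto simp: simple_graph_def)
  then have "finite E"
    by (rule finite_subset) simp
  moreover have "trail_gcds E r j i \<subseteq> (\<lambda>A. Gcd\<^sub>f\<^sub>i\<^sub>n (r ` A)) ` Pow E"
    by (auto simp: trail_gcds_def trail_gcd_def is_trail_def)
  ultimately show ?thesis
    by (meson finite_Pow_iff finite_imageI finite_subset)
qed

definition Q_vertex ::
  "nat \<Rightarrow> nat set set \<Rightarrow> (nat \<Rightarrow> 'a::ring_gcd) \<Rightarrow> (nat set \<Rightarrow> 'a) \<Rightarrow> nat \<Rightarrow> 'a" where
  "Q_vertex n E m r i = Lcm\<^sub>f\<^sub>i\<^sub>n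
     ({m i}
      \<union> {gcd (m j) (Lcm\<^sub>f\<^sub>i\<^sub>n (trail_gcds E r j i)) | j. i < j \<and> j < n}
      \<union> {Lcm\<^sub>f\<^sub>i\<^sub>n (trail_gcds E r s i) | s. s < i})"

definition Q_graph ::
  "nat \<Rightarrow> nat set set \<Rightarrow> (nat \<Rightarrow> 'a::ring_gcd) \<Rightarrow> (nat set \<Rightarrow> 'a) \<Rightarrow> 'a" where
  "Q_graph n E m r = (\<Prod>i<n. Q_vertex n E m r i)"

definition splines ::
  "nat \<Rightarrow> nat set set \<Rightarrow> (nat \<Rightarrow> 'a::comm_ring_1) \<Rightarrow> (nat set \<Rightarrow> 'a) \<Rightarrow> 'a vec set" where
  "splines n E m r = {f \<in> carrier_vec n.
     (\<forall>i<n. m i dvd f $ i) \<and> (\<forall>i<n. \<forall>j<n. {i, j} \<in> E \<longrightarrow> r {i, j} dvd f $ i - f $ j)}"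

definition spline_module ::
  "nat \<Rightarrow> nat set set \<Rightarrow> (nat \<Rightarrow> 'a::comm_ring_1) \<Rightarrow> (nat set \<Rightarrow> 'a) \<Rightarrow> ('a, 'a vec) module" where
  "spline_module n E m r = (module_vec TYPE('a) n)\<lparr>carrier := splines n E m r\<rparr>"

lemma module_spline_module:
  fixes m :: "nat \<Rightarrow> 'a::comm_ring_1"
  shows "Module.module (class_ring :: 'a ring) (spline_module n E m r)"
proof -
  interpret V: vec_module "TYPE('a)" n .
  have "submodule (class_ring :: 'a ring) (splines n E m r) (module_vec TYPE('a) n)"
    (is "submodule _ ?N _")
  proof (rule submodule.intro)
    show "Module.module (class_ring :: 'a ring) (module_vec TYPE('a) n)"
      by (rule V.module_axioms)
    show "?N \<subseteq> carrier (module_vec TYPE('a) n)"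
      by (auto simp: splines_def module_vec_simps)
    show "v \<oplus>\<^bsub>module_vec TYPE('a) n\<^esub> w \<in> ?N" if "v \<in> ?N" "w \<in> ?N" for v w
      using that
      by (auto simp: splines_def module_vec_simps add_diff_add intro!: dvd_add)
    show "\<zero>\<^bsub>module_vec TYPE('a) n\<^esub> \<in> ?N"
      by (simp add: splines_def module_vec_simps)
    show "c \<odot>\<^bsub>module_vec TYPE('a) n\<^esub> v \<in> ?N" if "v \<in> ?N" for c v
      using that
      by (auto simp: splines_def module_vec_simps simp flip: right_diff_distrib intro!: dvd_mult)
  qed
  then show ?thesis
    unfolding spline_module_def by (rule V.submodule_is_module)
qed

text \<open>
  The library's \<open>lin_dep\<close> and \<open>span\<close> refer to sets of vectors; injectivity makes this a statement
  about the family \<open>F\<close>, so that its members are in particular distinct.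
\<close>

definition module_basis ::
  "('a, 'b) ring_scheme \<Rightarrow> ('a, 'c, 'd) module_scheme \<Rightarrow> 'i set \<Rightarrow> ('i \<Rightarrow> 'c) \<Rightarrow> bool" where
  "module_basis R M I F \<longleftrightarrow> inj_on F I \<and> F ` I \<subseteq> carrier M \<and>
     \<not> LinearCombinations.module.lin_dep R M (F ` I) \<and>
     LinearCombinations.module.span R M (F ` I) = carrier M"

text \<open>Each column is a spline written from bottom to top, hence the reversed row index.\<close>

definition spline_det :: "nat \<Rightarrow> (nat \<Rightarrow> 'a::comm_ring_1 vec) \<Rightarrow> 'a" where
  "spline_det n F = det (mat n n (\<lambda>(a, i). F i $ (n - 1 - a)))"

end

theory Submission
  imports Defs
begin

text \<open>
  Since the labels are pairwise coprime, a trail with at least two edges has gcd \<open>1\<close>, and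
  \<open>Q_graph\<close> is associated to the product of all labels. Each vertex label divides a row of the
  matrix of splines and each edge label a difference of two rows, so this product divides the
  determinant. Conversely, for a label \<open>a\<close> with \<open>b\<close> the product of all other labels, there are
  \<open>n\<close> splines with determinant \<open>b\<^sup>n * a\<close>, and the determinant of a basis divides it. Hence the
  cofactor of the product in the determinant of a basis divides \<open>b\<^sup>n\<close> and is therefore coprime
  to \<open>a\<close>. This holds for every label, so the cofactor is a unit.
\<close>

section \<open>Products of pairwise coprime elements\<close>

lemma prod_dvd_of_pairwise_coprime:
  fixes f :: "'b \<Rightarrow> 'a::semiring_gcd"
  assumes "finite A"
    and "\<And>x y. x \<in> A \<Longrightarrow> y \<in> A \<Longrightarrow> x \<noteq> y \<Longrightarrow> coprime (f x) (f y)"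
    and "\<And>x. x \<in> A \<Longrightarrow> f x dvd c"
  shows "prod f A dvd c"
  using assms
proof (induction A rule: finite_induct)
  case (insert x A)
  have "coprime (f x) (prod f A)"
    using insert by (intro prod_coprime_right) (metis insertCI)
  then show ?case
    using insert by (simp add: divides_mult)
qed simp

text \<open>Cancelling \<open>f x\<close> leaves \<open>d\<close> dividing a power of a product
  coprime to \<open>f x\<close>. Hence \<open>d\<close> is coprime to every factor, and so to the
  very power that it divides.\<close>

lemma is_unit_of_dvd_pairwise_coprime:
  fixes f :: "'b \<Rightarrow> 'a::semiring_gcd"
  assumes fin: "finite A" and ne: "A \<noteq> {}"
    and cop: "\<And>x y. x \<in> A \<Longrightarrow> y \<in> A \<Longrightarrow> x \<noteq> y \<Longrightarrow> coprime (f x) (f y)"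
    and nz: "prod f A \<noteq> 0"
    and dvd: "\<And>x. x \<in> A \<Longrightarrow> prod f A * d dvd prod f (A - {x}) ^ k * f x"
  shows "is_unit d"
proof -
  have dvd_pow: "d dvd prod f (A - {x}) ^ k" if x: "x \<in> A" for x
  proof -
    have split: "prod f A = f x * prod f (A - {x})"
      using fin x by (rule prod.remove)
    have "f x * d dvd prod f A * d"
      unfolding split by (intro mult_dvd_mono) simp_all
    then have "f x * d dvd f x * prod f (A - {x}) ^ k"
      using dvd[OF x] by (metis dvd_trans mult.commute)
    moreover have "f x \<noteq> 0"
      using nz fin x by auto
    ultimately show ?thesis
      by simp
  qed
  have "coprime d (f x)" if x: "x \<in> A" for x
  proof -
    have "coprime (prod f (A - {x})) (f x)"
      using cop x by (intro prod_coprime_left) auto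
    then have "coprime (prod f (A - {x}) ^ k) (f x)"
      by simp
    then show ?thesis
      using dvd_pow[OF x] by (meson coprime_divisors dvd_refl)
  qed
  moreover obtain x where x: "x \<in> A"
    using ne by blast
  ultimately have "coprime d (prod f (A - {x}))"
    by (intro prod_coprime_right) auto
  then have "coprime d (prod f (A - {x}) ^ k)"
    by simp
  with dvd_pow[OF x] show ?thesis
    by (metis coprime_absorb_left)
qed

section \<open>Trails in a graph with pairwise coprime edge labels\<close>

lemma trail_gcd_edge_or_unit:
  assumes trail: "is_trail E j p i" and ne: "i \<noteq> j"
    and cop: "\<And>e e'. e \<in> E \<Longrightarrow> e' \<in> E \<Longrightarrow> e \<noteq> e' \<Longrightarrow> coprime (r e) (r e')"
  shows "trail_gcd r p dvd (if {j, i} \<in> E then r {j, i} else 1)"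
proof -
  \<comment> \<open>As \<open>i \<noteq> j\<close>, the trail has an edge; the split is between
    exactly one edge and at least two.\<close>
  consider (two) "p = [j, i]" | (many) y z zs where "p = j # y # z # zs"
    using trail ne
    by (cases p; cases "tl p"; cases "tl (tl p)") (auto simp: is_trail_def)
  then show ?thesis
  proof cases
    case two
    then show ?thesis
      using trail by (simp add: is_trail_def trail_gcd_def)
  next
    case many
    \<comment> \<open>The first two edges differ because a trail repeats no edge.\<close>
    then have "coprime (r {j, y}) (r {y, z})"
      using trail by (intro cop) (auto simp: is_trail_def)
    moreover have "trail_gcd r p dvd r {j, y}" "trail_gcd r p dvd r {y, z}"
      unfolding trail_gcd_def many by (intro Gcd_fin_dvd; simp)+
    ultimately have "is_unit (trail_gcd r p)"
      by (meson coprime_common_divisor)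
    then show ?thesis
      by (meson dvd_trans one_dvd)
  qed
qed

text \<open>Longer trails contribute only units, so at most the edge joining the two vertices
  matters. The converse for an edge is \<open>edge_dvd_Lcm_trail_gcds\<close>.\<close>

lemma Lcm_trail_gcds_dvd:
  assumes "simple_graph n E" and "i \<noteq> j"
    and "\<And>e e'. e \<in> E \<Longrightarrow> e' \<in> E \<Longrightarrow> e \<noteq> e' \<Longrightarrow> coprime (r e) (r e')"
  shows "Lcm\<^sub>f\<^sub>i\<^sub>n (trail_gcds E r j i) dvd (if {j, i} \<in> E then r {j, i} else 1)"
proof (rule Lcm_fin_least)
  show "finite (trail_gcds E r j i)"
    using assms(1) by (rule finite_trail_gcds)
  show "c dvd (if {j, i} \<in> E then r {j, i} else 1)" if c: "c \<in> trail_gcds E r j i" for c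
  proof -
    obtain p where "is_trail E j p i" "c = trail_gcd r p"
      using c by (auto simp: trail_gcds_def)
    then show ?thesis
      using trail_gcd_edge_or_unit[of E j p i r] assms(2,3) by blast
  qed
qed

lemma edge_dvd_Lcm_trail_gcds:
  assumes "{j, i} \<in> E"
  shows "r {j, i} dvd Lcm\<^sub>f\<^sub>i\<^sub>n (trail_gcds E r j i)"
proof -
  have "is_trail E j [j, i] i"
    using assms by (simp add: is_trail_def)
  then have "trail_gcd r [j, i] dvd Lcm\<^sub>f\<^sub>i\<^sub>n (trail_gcds E r j i)"
    by (intro dvd_Lcm_fin) (auto simp: trail_gcds_def)
  then show ?thesis
    by (simp add: trail_gcd_def)
qed

section \<open>Edge labels grouped by the larger endpoint\<close>

lemma finite_simple_graph:
  assumes "simple_graph n E"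
  shows "finite E"
  using assms by (auto simp: simple_graph_def intro: finite_subset[of E "Pow {..<n}"])

lemma edge_endpoints:
  assumes "simple_graph n E" and "e \<in> E"
  obtains s i where "s < i" and "i < n" and "e = {s, i}"
proof -
  have e: "card e = 2" "e \<subseteq> {..<n}"
    using assms by (auto simp: simple_graph_def)
  then obtain a b where ab: "e = {a, b}" "a \<noteq> b"
    by (meson card_2_iff)
  show thesis
    using that[of a b] that[of b a] ab e(2) by (cases "a < b") (auto simp: insert_commute)
qed

text \<open>Each edge is assigned to its larger endpoint. The entries for \<open>j > i\<close> are
  units, since \<open>m j\<close> is coprime to every edge label; the entries for
  \<open>s < i\<close> divide the label of \<open>{s, i}\<close>, or \<open>1\<close> if this is no
  edge.\<close>

lemma Q_vertex_dvd:
  assumes graph: "simple_graph n E" and i: "i < n"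
    and edges: "\<And>e e'. e \<in> E \<Longrightarrow> e' \<in> E \<Longrightarrow> e \<noteq> e' \<Longrightarrow> coprime (r e) (r e')"
    and vertex_edge: "\<And>i e. i < n \<Longrightarrow> e \<in> E \<Longrightarrow> coprime (m i) (r e)"
  shows "Q_vertex n E m r i dvd m i * (\<Prod>e\<in>{e \<in> E. Max e = i}. r e)"
  unfolding Q_vertex_def
proof (rule Lcm_fin_least)
  let ?P = "m i * (\<Prod>e\<in>{e \<in> E. Max e = i}. r e)"
  let ?w = "\<lambda>j. if {j, i} \<in> E then r {j, i} else 1"
  show "finite ({m i} \<union> {gcd (m j) (Lcm\<^sub>f\<^sub>i\<^sub>n (trail_gcds E r j i)) | j. i < j \<and> j < n}
      \<union> {Lcm\<^sub>f\<^sub>i\<^sub>n (trail_gcds E r s i) | s. s < i})"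
    by simp
  have later: "gcd (m j) (Lcm\<^sub>f\<^sub>i\<^sub>n (trail_gcds E r j i)) dvd ?P" if j: "i < j" "j < n" for j
  proof -
    have "Lcm\<^sub>f\<^sub>i\<^sub>n (trail_gcds E r j i) dvd ?w j"
      using graph j edges by (intro Lcm_trail_gcds_dvd) auto
    moreover have "coprime (m j) (?w j)"
      using j vertex_edge by simp
    ultimately have "coprime (m j) (Lcm\<^sub>f\<^sub>i\<^sub>n (trail_gcds E r j i))"
      by (meson coprime_divisors dvd_refl)
    then show ?thesis
      by simp
  qed
  have earlier: "Lcm\<^sub>f\<^sub>i\<^sub>n (trail_gcds E r s i) dvd ?P" if s: "s < i" for s
  proof -
    have "Lcm\<^sub>f\<^sub>i\<^sub>n (trail_gcds E r s i) dvd ?w s"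
      using graph s edges by (intro Lcm_trail_gcds_dvd) auto
    also have "?w s dvd (\<Prod>e\<in>{e \<in> E. Max e = i}. r e)"
      using s finite_simple_graph[OF graph] by (auto intro!: dvd_prodI simp: max_def)
    finally show ?thesis
      by (rule dvd_mult)
  qed
  show "c dvd ?P" if "c \<in> {m i} \<union> {gcd (m j) (Lcm\<^sub>f\<^sub>i\<^sub>n (trail_gcds E r j i)) | j. i < j \<and> j < n}
      \<union> {Lcm\<^sub>f\<^sub>i\<^sub>n (trail_gcds E r s i) | s. s < i}" for c
    using that later earlier by auto
qed

text \<open>The factors on the left are pairwise coprime, so it suffices that each of them divides
  some entry of the lcm.\<close>

lemma dvd_Q_vertex:
  assumes graph: "simple_graph n E" and i: "i < n"
    and edges: "\<And>e e'. e \<in> E \<Longrightarrow> e' \<in> E \<Longrightarrow> e \<noteq> e' \<Longrightarrow> coprime (r e) (r e')"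
    and vertex_edge: "\<And>i e. i < n \<Longrightarrow> e \<in> E \<Longrightarrow> coprime (m i) (r e)"
  shows "m i * (\<Prod>e\<in>{e \<in> E. Max e = i}. r e) dvd Q_vertex n E m r i"
proof (rule divides_mult)
  show "m i dvd Q_vertex n E m r i"
    unfolding Q_vertex_def by (intro dvd_Lcm_fin) simp
  show "(\<Prod>e\<in>{e \<in> E. Max e = i}. r e) dvd Q_vertex n E m r i"
  proof (rule prod_dvd_of_pairwise_coprime)
    fix e assume e: "e \<in> {e \<in> E. Max e = i}"
    then obtain s where s: "s < i" "e = {s, i}"
      by (auto simp: max_def elim: edge_endpoints[OF graph])
    then have "r e dvd Lcm\<^sub>f\<^sub>i\<^sub>n (trail_gcds E r s i)"
      using e by (simp add: edge_dvd_Lcm_trail_gcds)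
    also have "\<dots> dvd Q_vertex n E m r i"
      unfolding Q_vertex_def using s by (intro dvd_Lcm_fin) auto
    finally show "r e dvd Q_vertex n E m r i" .
  qed (use edges finite_simple_graph[OF graph] in auto)
  show "coprime (m i) (\<Prod>e\<in>{e \<in> E. Max e = i}. r e)"
    using vertex_edge i by (intro prod_coprime_right) auto
qed

text \<open>The disjoint sum makes vertex and edge labels a single family. The fibres of
  \<open>Max\<close> partition the edges.\<close>

lemma prod_labels_eq:
  fixes m :: "nat \<Rightarrow> 'a::comm_monoid_mult"
  assumes graph: "simple_graph n E"
  shows "prod (case_sum m r) ({..<n} <+> E) = (\<Prod>i<n. m i * (\<Prod>e\<in>{e \<in> E. Max e = i}. r e))"
proof -
  have "Max ` E \<subseteq> {..<n}"
    by (auto simp: max_def elim: edge_endpoints[OF graph])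
  then have "(\<Prod>i<n. \<Prod>e\<in>{e \<in> E. Max e = i}. r e) = prod r E"
    by (intro prod.group finite_simple_graph[OF graph]) auto
  then show ?thesis
    using finite_simple_graph[OF graph] by (simp add: prod.Plus prod.distrib o_def)
qed

section \<open>Determinants of splines\<close>

text \<open>Row indices agree with vertices here, which lets the test matrices below be triangular;
  \<open>spline_det\<close> reverses the rows.\<close>

definition spline_mat :: "nat \<Rightarrow> (nat \<Rightarrow> 'a::comm_ring_1 vec) \<Rightarrow> 'a mat" where
  "spline_mat n F = mat n n (\<lambda>(a, i). F i $ a)"

lemma spline_mat_carrier [simp]: "spline_mat n F \<in> carrier_mat n n"
  by (simp add: spline_mat_def)

lemma spline_det_eq_unit_mult_det:
  fixes F :: "nat \<Rightarrow> 'a::comm_ring_1 vec"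
  obtains u where "u dvd 1" and "spline_det n F = u * det (spline_mat n F)"
proof -
  \<comment> \<open>The reversal of the rows, extended by the identity because
    \<open>permutes\<close> demands it; it is its own inverse.\<close>
  define p where "p = (\<lambda>a. if a < n then n - 1 - a else a)"
  have p: "p permutes {0..<n}"
    by (intro bij_imp_permutes bij_betw_byWitness[where f' = p]) (auto simp: p_def)
  have "spline_det n F = det (mat n n (\<lambda>(a, i). spline_mat n F $$ (p a, i)))"
    unfolding spline_det_def spline_mat_def
    by (intro arg_cong[of _ _ det] eq_matI) (auto simp: p_def)
  also have "\<dots> = signof p * det (spline_mat n F)"
    using p by (intro det_permute_rows) auto
  finally have "spline_det n F = signof p * det (spline_mat n F)" .
  moreover have "(signof p :: 'a) dvd 1"
    by (simp add: sign_def)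
  ultimately show thesis
    using that by blast
qed

lemma dvd_det_of_dvd_row:
  fixes A :: "'a::comm_ring_1 mat"
  assumes "A \<in> carrier_mat n n" and "k < n" and "\<And>j. j < n \<Longrightarrow> a dvd A $$ (k, j)"
  shows "a dvd det A"
  using assms by (subst laplace_expansion_row[of A n k]) (auto intro!: dvd_sum)

lemma prod_labels_dvd_det:
  fixes m :: "nat \<Rightarrow> 'a::ring_gcd"
  assumes graph: "simple_graph n E"
    and cop: "\<And>x y. x \<in> {..<n} <+> E \<Longrightarrow> y \<in> {..<n} <+> E \<Longrightarrow> x \<noteq> y \<Longrightarrow>
      coprime (case_sum m r x) (case_sum m r y)"
    and F: "\<And>k. k < n \<Longrightarrow> F k \<in> splines n E m r"
  shows "prod (case_sum m r) ({..<n} <+> E) dvd det (spline_mat n F)"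
proof (rule prod_dvd_of_pairwise_coprime)
  show "finite ({..<n} <+> E)"
    using finite_simple_graph[OF graph] by simp
  have vertex: "m i dvd det (spline_mat n F)" if "i < n" for i
    using that F by (intro dvd_det_of_dvd_row[of _ n i]) (auto simp: spline_mat_def splines_def)
  have edge: "r e dvd det (spline_mat n F)" if e: "e \<in> E" for e
  proof -
    obtain s i where s: "s < i" "i < n" "e = {s, i}"
      using graph e by (rule edge_endpoints)
    \<comment> \<open>Subtracting row \<open>s\<close> from row \<open>i\<close> keeps the
      determinant and fills row \<open>i\<close> with the differences that the spline condition
      controls.\<close>
    have "r e dvd det (addrow (- 1) i s (spline_mat n F))"
    proof (rule dvd_det_of_dvd_row[of _ n i])
      fix k assume "k < n"
      moreover have "{i, s} \<in> E"
        using e s by (simp add: insert_commute)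
      ultimately have "r {i, s} dvd F k $ i - F k $ s"
        using F[of k] s by (simp add: splines_def)
      then show "r e dvd addrow (- 1) i s (spline_mat n F) $$ (i, k)"
        using s \<open>k < n\<close> by (simp add: spline_mat_def insert_commute)
    qed (use s in \<open>auto simp: spline_mat_def\<close>)
    then show ?thesis
      using s by (simp add: det_addrow[of _ n])
  qed
  show "case_sum m r x dvd det (spline_mat n F)" if "x \<in> {..<n} <+> E" for x
    using that vertex edge by auto
qed (use cop in auto)

section \<open>Change of basis and explicit test splines\<close>

lemma lincomb_splines_index:
  fixes m :: "nat \<Rightarrow> 'a::comm_ring_1"
  assumes "finite A" and "A \<subseteq> splines n E m r" and i: "i < n"
  shows "LinearCombinations.module.lincomb (spline_module n E m r) c A $ i
    = (\<Sum>v\<in>A. c v * v $ i)"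
  using assms(1,2)
proof (induction A rule: finite_induct)
  let ?M = "spline_module n E m r"
  interpret S: Module.module "class_ring :: 'a ring" ?M
    by (rule module_spline_module)
  case empty
  have "S.lincomb c {} = \<zero>\<^bsub>?M\<^esub>"
    unfolding S.lincomb_def by (rule S.finsum_empty)
  then show ?case
    using i by (simp add: spline_module_def module_vec_simps)
next
  let ?M = "spline_module n E m r"
  interpret S: Module.module "class_ring :: 'a ring" ?M
    by (rule module_spline_module)
  case (insert x A)
  have carrier: "carrier ?M = splines n E m r"
    by (simp add: spline_module_def)
  have smult: "c v \<odot>\<^bsub>?M\<^esub> v \<in> carrier ?M" if "v \<in> insert x A" for v
    using that insert.prems carrier by (intro S.smult_closed) (auto simp: class_ring_simps)
  have "S.lincomb c (insert x A) = c x \<odot>\<^bsub>?M\<^esub> x \<oplus>\<^bsub>?M\<^esub> S.lincomb c A"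
    unfolding S.lincomb_def using insert smult by (intro S.finsum_insert) auto
  then have "S.lincomb c (insert x A) = c x \<cdot>\<^sub>v x + S.lincomb c A"
    by (simp add: spline_module_def module_vec_simps)
  \<comment> \<open>Closure supplies the dimension needed to index the vector sum.\<close>
  moreover have "S.lincomb c A \<in> splines n E m r"
    unfolding S.lincomb_def carrier[symmetric] using smult by (intro S.finsum_closed) auto
  then have "dim_vec (S.lincomb c A) = n"
    by (simp add: splines_def)
  moreover have "dim_vec x = n"
    using insert.prems by (auto simp: splines_def)
  moreover have "S.lincomb c A $ i = (\<Sum>v\<in>A. c v * v $ i)"
    using insert by simp
  ultimately show ?case
    using insert.hyps i by simp
qed

lemma det_basis_dvd_det:
  fixes m :: "nat \<Rightarrow> 'a::comm_ring_1"
  assumes basis: "module_basis class_ring (spline_module n E m r) {..<n} F"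
    and G: "\<And>k. k < n \<Longrightarrow> G k \<in> splines n E m r"
  shows "det (spline_mat n F) dvd det (spline_mat n G)"
proof -
  let ?M = "spline_module n E m r"
  interpret S: Module.module "class_ring :: 'a ring" ?M
    by (rule module_spline_module)
  have inj: "inj_on F {..<n}" and F: "F ` {..<n} \<subseteq> splines n E m r"
    and span: "S.span (F ` {..<n}) = splines n E m r"
    using basis by (auto simp: module_basis_def spline_module_def)
  have "\<exists>c. G k = S.lincomb c (F ` {..<n})" if "k < n" for k
    using G[OF that] S.finite_span[of "F ` {..<n}"] F span by (auto simp: spline_module_def)
  then obtain c where c: "\<And>k. k < n \<Longrightarrow> G k = S.lincomb (c k) (F ` {..<n})"
    by metis
  \<comment> \<open>Column \<open>k\<close> holds the coefficients of \<open>G k\<close> in terms of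
    \<open>F\<close>; injectivity of \<open>F\<close> turns the sum over the set of vectors into a
    sum over indices.\<close>
  define C where "C = mat n n (\<lambda>(j, k). c k (F j))"
  have "spline_mat n G = spline_mat n F * C"
  proof (rule eq_matI)
    fix i k assume "i < dim_row (spline_mat n F * C)" "k < dim_col (spline_mat n F * C)"
    then have i: "i < n" and k: "k < n"
      by (simp_all add: spline_mat_def C_def)
    have "G k $ i = (\<Sum>j<n. c k (F j) * F j $ i)"
      unfolding c[OF k] lincomb_splines_index[OF finite_imageI[OF finite_lessThan] F i]
      using inj by (simp add: sum.reindex)
    then show "spline_mat n G $$ (i, k) = (spline_mat n F * C) $$ (i, k)"
      using i k by (simp add: spline_mat_def C_def scalar_prod_def mult.commute lessThan_atLeast0)
  qed (simp_all add: spline_mat_def C_def)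
  moreover have "C \<in> carrier_mat n n"
    by (simp add: C_def)
  ultimately show ?thesis
    by (simp add: det_mult[of _ n])
qed

text \<open>
  The splines \<open>b e\<^sub>k\<close>, except that \<open>b e\<^sub>j\<close> is multiplied by \<open>a\<close> and, for an edge \<open>{s, j}\<close>,
  the spline \<open>b e\<^sub>s\<close> is replaced by \<open>b (e\<^sub>s + e\<^sub>j)\<close>.
\<close>

lemma ex_splines_det:
  fixes m :: "nat \<Rightarrow> 'a::comm_ring_1"
  assumes graph: "simple_graph n E" and x: "x \<in> {..<n} <+> E"
  obtains G where "\<And>k. k < n \<Longrightarrow> G k \<in> splines n E m r"
    and "det (spline_mat n G)
      = prod (case_sum m r) ({..<n} <+> E - {x}) ^ n * case_sum m r x"
proof -
  define a where "a = case_sum m r x"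
  define b where "b = prod (case_sum m r) ({..<n} <+> E - {x})"
  have dvd_b: "case_sum m r y dvd b" if "y \<in> {..<n} <+> E" "y \<noteq> x" for y
    unfolding b_def using that finite_simple_graph[OF graph] by (intro dvd_prodI) auto
  have dvd_b_vertex: "m i dvd b" if "i < n" "x \<noteq> Inl i" for i
    using dvd_b[of "Inl i"] that by auto
  have dvd_b_edge: "r e dvd b" if "e \<in> E" "x \<noteq> Inr e" for e
    using dvd_b[of "Inr e"] that by auto
  have prod_eq: "(\<Prod>i<n. if i = j then b * a else b) = b ^ n * a" if "j < n" for j
  proof -
    have "(\<Prod>i<n. if i = j then b * a else b) = (\<Prod>i<n. b * (if i = j then a else 1))"
      by (intro prod.cong) auto
    also have "\<dots> = b ^ n * a"
      using that by (simp add: prod.distrib prod.delta)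
    finally show ?thesis .
  qed
  \<comment> \<open>This serves both kinds of label: the only possible off-diagonal entry is in row
    \<open>j\<close> and column \<open>s\<close> with \<open>s < j\<close>, hence below the
    diagonal.\<close>
  have det_eq: "det (spline_mat n G) = b ^ n * a"
    if "j < n" and diag: "\<And>i. i < n \<Longrightarrow> G i $ i = (if i = j then b * a else b)"
      and lower: "\<And>i k. i < k \<Longrightarrow> k < n \<Longrightarrow> G k $ i = 0" for G :: "nat \<Rightarrow> 'a vec" and j
  proof -
    have "det (spline_mat n G) = prod_list (diag_mat (spline_mat n G))"
      using lower by (intro det_lower_triangular[of n]) (auto simp: spline_mat_def)
    also have "\<dots> = (\<Prod>i<n. if i = j then b * a else b)"
      unfolding prod_list_diag_prod lessThan_atLeast0
      using diag by (intro prod.cong) (auto simp: spline_mat_def)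
    finally show ?thesis
      using prod_eq[OF that(1)] by simp
  qed
  show thesis
  proof (cases x)
    case (Inl j)
    then have j: "j < n" and a: "a = m j"
      using x by (auto simp: a_def)
    define G where "G = (\<lambda>k. vec n (\<lambda>i. if i = k then (if k = j then b * a else b) else 0))"
    \<comment> \<open>Every label except \<open>m j\<close> divides \<open>b\<close>, and the entry
      at vertex \<open>j\<close> is \<open>b * a\<close> or \<open>0\<close>.\<close>
    have "G k \<in> splines n E m r" for k
      using dvd_b_vertex dvd_b_edge Inl a by (auto simp: G_def splines_def)
    moreover have "det (spline_mat n G) = b ^ n * a"
      using j by (intro det_eq[of j]) (auto simp: G_def)
    ultimately show thesis
      using that unfolding a_def b_def by blast
  next
    case (Inr e)
    then have e: "e \<in> E" and a: "a = r e"
      using x by (auto simp: a_def)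
    obtain s j where s: "s < j" "j < n" "e = {s, j}"
      using graph e by (rule edge_endpoints)
    define G where "G = (\<lambda>k. vec n (\<lambda>i. if i = k then (if k = j then b * a else b)
      else if k = s \<and> i = j then b else 0))"
    have "G k \<in> splines n E m r" for k
      unfolding splines_def
    proof (intro CollectI conjI allI impI)
      show "G k \<in> carrier_vec n"
        by (simp add: G_def)
      show "m i dvd G k $ i" if "i < n" for i
        using that dvd_b_vertex Inr by (auto simp: G_def)
      show "r {i, i'} dvd G k $ i - G k $ i'" if "i < n" "i' < n" "{i, i'} \<in> E" for i i'
      proof (cases "{i, i'} = e")
        \<comment> \<open>Across the chosen edge the difference vanishes except for
          \<open>k = j\<close>, where it is \<open>b * a\<close> up to sign; for
          \<open>k = s\<close> the two entries \<open>b\<close> cancel.\<close>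
        case True
        then have "i = s \<and> i' = j \<or> i = j \<and> i' = s"
          using s by (auto simp: doubleton_eq_iff)
        then show ?thesis
          using True that s a by (auto simp: G_def)
      next
        case False
        then have b: "r {i, i'} dvd b"
          using that dvd_b_edge Inr by auto
        have "r {i, i'} dvd G k $ l" if "l < n" for l
          using b that by (auto simp: G_def)
        then show ?thesis
          using that by (intro dvd_diff) auto
      qed
    qed
    moreover have "det (spline_mat n G) = b ^ n * a"
      using s by (intro det_eq[of j]) (auto simp: G_def)
    ultimately show thesis
      using that unfolding a_def b_def by blast
  qed
qed

section \<open>Comparison of the determinant with the product of all labels\<close>

theorem theorem1p2:
  fixes n :: nat
    and E :: "nat set set"
    and m :: "nat \<Rightarrow> 'a::ring_gcd"
    and r :: "nat set \<Rightarrow> 'a"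
    and F :: "nat \<Rightarrow> 'a vec"
  assumes graph: "simple_graph n E"
    and coprime_vertices: "\<And>i j. i < n \<Longrightarrow> j < n \<Longrightarrow> i \<noteq> j \<Longrightarrow> coprime (m i) (m j)"
    and coprime_edges: "\<And>e e'. e \<in> E \<Longrightarrow> e' \<in> E \<Longrightarrow> e \<noteq> e' \<Longrightarrow> coprime (r e) (r e')"
    and coprime_vertex_edge: "\<And>i e. i < n \<Longrightarrow> e \<in> E \<Longrightarrow> coprime (m i) (r e)"
    and basis: "module_basis class_ring (spline_module n E m r) {..<n} F"
  shows "\<exists>u. is_unit u \<and> spline_det n F = u * Q_graph n E m r"
proof -
  let ?L = "{..<n} <+> E"
  let ?l = "case_sum m r"
  let ?D = "det (spline_mat n F)"
  have cop: "coprime (?l x) (?l y)" if "x \<in> ?L" "y \<in> ?L" "x \<noteq> y" for x y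
    using that
    by (elim PlusE) (auto intro: coprime_vertices coprime_edges coprime_vertex_edge
      simp: coprime_commute[of "r _" "m _"])
  have Q1: "Q_graph n E m r dvd prod ?l ?L"
    unfolding Q_graph_def prod_labels_eq[OF graph]
    using graph coprime_edges coprime_vertex_edge by (intro prod_dvd_prod Q_vertex_dvd) auto
  have Q2: "prod ?l ?L dvd Q_graph n E m r"
    unfolding Q_graph_def prod_labels_eq[OF graph]
    using graph coprime_edges coprime_vertex_edge by (intro prod_dvd_prod dvd_Q_vertex) auto
  have F: "F k \<in> splines n E m r" if "k < n" for k
    using basis that by (auto simp: module_basis_def spline_module_def)
  have D1: "prod ?l ?L dvd ?D"
    using graph cop F by (rule prod_labels_dvd_det)
  then obtain d where d: "?D = prod ?l ?L * d"
    by blast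
  have "?D dvd prod ?l ?L"
  \<comment> \<open>The cancellation argument needs a nonempty family with nonzero product.
    Otherwise the determinant is the empty one, \<open>1\<close>, or the claim is divisibility of
    \<open>0\<close>.\<close>
  proof (cases "n = 0 \<or> prod ?l ?L = 0")
    case True
    then show ?thesis
      using d by (auto simp: spline_mat_def)
  next
    case False
    have "is_unit d"
    proof (rule is_unit_of_dvd_pairwise_coprime[of ?L ?l d n])
      fix x assume "x \<in> ?L"
      then obtain G where "\<And>k. k < n \<Longrightarrow> G k \<in> splines n E m r"
        and "det (spline_mat n G) = prod ?l (?L - {x}) ^ n * ?l x"
        using ex_splines_det[OF graph] by metis
      then show "prod ?l ?L * d dvd prod ?l (?L - {x}) ^ n * ?l x"
        using det_basis_dvd_det[OF basis, of G] d by simp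
    qed (use False cop finite_simple_graph[OF graph] in auto)
    then show ?thesis
      using d by simp
  qed
  with D1 Q1 Q2 have "?D dvd Q_graph n E m r" "Q_graph n E m r dvd ?D"
    by (meson dvd_trans)+
  then have "normalize ?D = normalize (Q_graph n E m r)"
    by (rule associatedI)
  then obtain v where "is_unit v" "?D = v * Q_graph n E m r"
    by (rule associatedE1)
  \<comment> \<open>The sign of the row reversal is absorbed into the unit.\<close>
  moreover obtain u where "is_unit u" "spline_det n F = u * ?D"
    by (rule spline_det_eq_unit_mult_det)
  ultimately have "is_unit (u * v)" "spline_det n F = u * v * Q_graph n E m r"
    by (simp_all add: mult.assoc)
  then show ?thesis
    by blast
qed

end
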